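(* Let $f(z)=\sum_{n\ge0} a_n z^{-n}\in\mathbb{C}[[z^{-1}]]$ be a Gevrey-1 formal series with Borel transform $\widetilde f(\zeta)=\sum_{n\ge1} \frac{a_n\zeta^{n-1}}{(n-1)!}$. Let $\lambda>0$ and assume that $\widetilde f$ extends holomorphically to $\Delta_\lambda$ and that there exist $A>0$, $B>0$ with $|\widetilde f(\zeta)|\le A e^{B|\zeta|}$ for all $\zeta\in\Delta_\lambda$. Put $a_n^{(\lambda)}=\lambda^{n-1}a_n$ and, for $n\ge0$, $$b_n^{(\lambda)}=\frac{1}{n!}\sum_{k=1}^{n+1}(-1)^{n-k+1}\mathfrak{s}(n,k-1)\,a_k^{(\lambda)}.$$ Then: (i) the factorial series $a_0+\lambda\sum_{n=0}^{+\infty}\frac{\Gamma(\lambda z)\Gamma(n+1)b_n^{(\lambda)}}{\Gamma(\lambda z+n+1)}$ converges absolutely for $\Re(z)>\max(B,1/\lambda)$, and its sum equals $\mathrm{S}_0 f(z)$ there; (ii) for every integer $N\ge0$ and every $z$ with $\Re(z)>B$, $$\Big|\mathrm{S}_0f(z)-\Big(a_0+\lambda\sum_{n=0}^{N}\frac{\Gamma(\lambda z)\Gamma(n+1)b_n^{(\lambda)}}{\Gamma(\lambda z+n+1)}\Big)\Big|\le R_{fact}(\lambda,A,B,N,z),$$ where $$R_{fact}(\lambda,A,B,N,z)=\frac{A}{(\lambda B)^{\lambda B}}\,\frac{(N+\lambda B+1)^{N+\lambda B+1}}{(N+1)^N}\left|\frac{\Gamma(\lambda z)\Gamma(N+1)}{\Gamma(\lambda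 z+N+1)(\Re(z)-B)}\right|.$$
   Context: $\Delta$ denotes the image of the open disc $D(1,1)=\{s:|s-1|<1\}$ under $s\mapsto-\ln s$ (principal logarithm), and $\Delta_\lambda=\{\lambda\zeta:\zeta\in\Delta\}$. A series $\sum a_n z^{-n}$ is Gevrey-1 if $|a_n|\le CK^n n!$ for some constants. The Borel sum is $\mathrm{S}_0 f(z)=a_0+\int_0^{+\infty}\widetilde f(\zeta)e^{-z\zeta}\,d\zeta$ ($\Re z>B$). Stirling numbers of the first kind: $\prod_{k=0}^{n-1}(x-k)=\sum_{k=0}^n\mathfrak{s}(n,k)x^k$. *)

theory Defs
  imports "HOL-Complex_Analysis.Complex_Analysis" "HOL-Computational_Algebra.Polynomial"
begin

definition Delta :: "complex set" where
  "Delta = (\<lambda>s. - Ln s) ` ball 1 1"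

definition Delta_lam :: "real \<Rightarrow> complex set" where
  "Delta_lam lam = (\<lambda>\<zeta>. complex_of_real lam * \<zeta>) ` Delta"

definition stirling1 :: "nat \<Rightarrow> nat \<Rightarrow> int" where
  "stirling1 n k = coeff (\<Prod>j<n. [: - of_nat j, 1 :]) k"

definition gevrey1 :: "(nat \<Rightarrow> complex) \<Rightarrow> bool" where
  "gevrey1 a \<longleftrightarrow> (\<exists>C K. \<forall>n. norm (a n) \<le> C * K ^ n * fact n)"

definition borel_transform :: "(nat \<Rightarrow> complex) \<Rightarrow> complex \<Rightarrow> complex" where
  "borel_transform a \<zeta> = (\<Sum>n. a (Suc n) * \<zeta> ^ n / fact n)"

text \<open>Borel sum S_0 f(z) = a_0 + int_0^infty F(zeta) e^{-z zeta} d zeta, with F the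
  holomorphic extension of the Borel transform.\<close>
definition borel_sum :: "complex \<Rightarrow> (complex \<Rightarrow> complex) \<Rightarrow> complex \<Rightarrow> complex" where
  "borel_sum a0 F z = a0 + integral {0..} (\<lambda>t::real. F (of_real t) * exp (- (z * of_real t)))"

definition a_lam :: "real \<Rightarrow> (nat \<Rightarrow> complex) \<Rightarrow> nat \<Rightarrow> complex" where
  "a_lam lam a n = complex_of_real lam ^ (n - 1) * a n"

definition b_lam :: "real \<Rightarrow> (nat \<Rightarrow> complex) \<Rightarrow> nat \<Rightarrow> complex" where
  "b_lam lam a n = (1 / fact n) *
     (\<Sum>k=1..n+1. (-1) ^ (n + 1 - k) * of_int (stirling1 n (k - 1)) * a_lam lam a k)"

definition fact_term :: "real \<Rightarrow> (nat \<Rightarrow> complex) \<Rightarrow> complex \<Rightarrow> nat \<Rightarrow> complex" where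
  "fact_term lam a z n =
     Gamma (of_real lam * z) * Gamma (of_nat n + 1) * b_lam lam a n
       / Gamma (of_real lam * z + of_nat n + 1)"

definition R_fact :: "real \<Rightarrow> real \<Rightarrow> real \<Rightarrow> nat \<Rightarrow> complex \<Rightarrow> real" where
  "R_fact lam A B N z =
     A / ((lam * B) powr (lam * B))
     * ((real N + lam * B + 1) powr (real N + lam * B + 1) / (real N + 1) ^ N)
     * norm (Gamma (of_real lam * z) * Gamma (of_nat N + 1)
             / (Gamma (of_real lam * z + of_nat N + 1) * of_real (Re z - B)))"

end

theory Submission
  imports Defs
begin

text \<open>
  Put \<open>h s = F (- lam Ln s)\<close>, a holomorphic function on the disc \<open>|s - 1| < 1\<close>. The substitution
  \<open>t = - lam ln s\<close> turns the Laplace integral into \<open>lam \<integral> h s * s powr (lam z - 1) ds\<close> over \<open>(0, 1)\<close>,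
  and the \<open>b_lam\<close> are the Taylor coefficients of \<open>h\<close> at \<open>1\<close> in powers of \<open>1 - s\<close>. Integrating by
  parts \<open>N + 1\<close> times gives the partial sum of the factorial series plus an integral of the
  \<open>(N + 1)\<close>-st derivative of \<open>h\<close>, and Cauchy's estimate on circles of radius \<open>\<rho> s\<close> about \<open>s\<close>,
  with optimal \<open>\<rho>\<close>, bounds that integral by \<open>R_fact\<close>. This bound need not tend to \<open>0\<close> on the whole
  half-plane of (i); there the Taylor series is integrated term by term, using the sharper
  coefficient bound \<open>O(n powr (b - 1))\<close> for \<open>b > max (lam B) 1\<close> that an \<open>L\<^sup>1\<close> estimate on circles
  about \<open>1\<close> provides.
\<close>

section \<open>Elementary inequalities for the logarithm and the sine\<close>

text \<open>The power series of \<open>- ln (1 - x)\<close> has as coefficients the absolute values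
  of those of \<open>Ln (1 + u)\<close>, so the two compare term by term.\<close>

lemma norm_Ln_one_plus_le:
  fixes u :: complex
  assumes "norm u < 1"
  shows "norm (Ln (1 + u)) \<le> - ln (1 - norm u)"
proof -
  have s: "(\<lambda>n. - ((-u) ^ n) / of_nat n) sums Ln (1 + u)"
    using Ln_series'[OF assms] by simp
  have "(\<lambda>n. - ((- (- norm u)) ^ n) / real n) sums ln (1 + - norm u)"
    by (rule ln_series') (use assms in auto)
  from sums_minus[OF this] have t: "(\<lambda>n. norm u ^ n / real n) sums - ln (1 - norm u)"
    by simp
  have "norm (\<Sum>n. - ((-u) ^ n) / of_nat n) \<le> (\<Sum>n. norm u ^ n / real n)"
    by (rule norm_suminf_le[OF _ sums_summable[OF t]]) (simp add: norm_divide norm_power)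
  then show ?thesis using s t by (simp add: sums_iff)
qed

text \<open>Jordan's inequality: by concavity the sine lies above its chord from \<open>0\<close> to
  \<open>pi/2\<close>.\<close>

lemma sin_ge_chord:
  fixes x :: real
  assumes "0 \<le> x" "x \<le> 1 / 2"
  shows "2 * x \<le> sin (pi * x)"
proof -
  have "concave_on {0..pi/2} sin"
    by (rule f''_le0_imp_concave[where f' = cos and f'' = "\<lambda>x. - sin x"])
      (auto intro!: derivative_eq_intros sin_ge_zero)
  from concave_onD[OF this, of "2 * x" 0 "pi/2"] assms show ?thesis
    by (simp add: mult.commute)
qed

text \<open>\<open>borel_transform\<close> is a \<open>suminf\<close>, so agreement with it carries
  information only where the series converges. The Gevrey bound provides convergence near
  \<open>0\<close>, and the coefficients can then be read off.\<close>

lemma borel_transform_higher_deriv_0: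
  assumes gev: "gevrey1 a" and r: "r > 0"
    and eq: "\<And>\<zeta>. \<zeta> \<in> ball 0 r \<Longrightarrow> F \<zeta> = borel_transform a \<zeta>"
  shows "(deriv ^^ n) F 0 = a (Suc n)"
proof -
  obtain C K where CK: "\<And>n. norm (a n) \<le> C * K ^ n * fact n"
    using gev unfolding gevrey1_def by blast
  \<comment> \<open>On the disc of radius \<open>1 / L\<close> this forces
    \<open>\<bar>K\<bar> * norm \<zeta> < 1/2\<close>; the summand \<open>1\<close> keeps
    \<open>L\<close> positive when \<open>K = 0\<close>. Absolute values are taken because the sign
    of \<open>K\<close> is not known.\<close>
  define L where "L = 2 * \<bar>K\<bar> + 1"
  define f where "f = Abs_fps (\<lambda>n. a (Suc n) / fact n)"
  have C0: "0 \<le> C" using order_trans[OF norm_ge_zero CK[of 0]] by simp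
  have L: "L > 0" by (simp add: L_def)
  have "(\<lambda>n. fps_nth f n * \<zeta> ^ n) sums F \<zeta>" if z: "\<zeta> \<in> ball 0 (min r (1 / L))" for \<zeta>
  proof -
    have zL: "norm \<zeta> * L < 1" using z L by (simp add: field_simps)
    define x where "x = \<bar>K\<bar> * norm \<zeta>"
    have x: "0 \<le> x" "x < 1/2"
      using zL by (auto simp: x_def L_def algebra_simps) (smt (verit) norm_ge_zero)
    \<comment> \<open>The bound on \<open>a (Suc n)\<close> contains \<open>fact (Suc n)\<close>,
      but the Borel transform divides by \<open>fact n\<close> only; the remaining factor
      \<open>Suc n\<close> makes the majorant a differentiated geometric series.\<close>
    have sm: "summable (\<lambda>n. C * \<bar>K\<bar> * (real (Suc n) * x ^ n))"
      using x geometric_deriv_sums[of x] by (intro summable_mult) (auto simp: sums_iff)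
    have bd: "norm (fps_nth f n * \<zeta> ^ n) \<le> C * \<bar>K\<bar> * (real (Suc n) * x ^ n)" for n
    proof -
      have "norm (a (Suc n)) \<le> C * \<bar>K\<bar> ^ Suc n * fact (Suc n)"
        using order_trans[OF CK[of "Suc n"], of "C * \<bar>K\<bar> ^ Suc n * fact (Suc n)"] C0
          abs_ge_self[of "K ^ Suc n"]
        by (simp add: mult_left_mono mult_right_mono power_abs abs_mult del: power_Suc fact_Suc)
      then have "norm (a (Suc n)) / fact n * norm \<zeta> ^ n \<le> C * \<bar>K\<bar> ^ Suc n * fact (Suc n) / fact n * norm \<zeta> ^ n"
        by (intro mult_right_mono divide_right_mono) auto
      also have "\<dots> = C * \<bar>K\<bar> * (real (Suc n) * x ^ n)"
        by (simp add: x_def power_mult_distrib field_simps)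
      finally show ?thesis by (simp add: f_def norm_mult norm_divide norm_power)
    qed
    have "summable (\<lambda>n. fps_nth f n * \<zeta> ^ n)"
      by (rule summable_comparison_test'[OF sm bd])
    then have "(\<lambda>n. fps_nth f n * \<zeta> ^ n) sums (\<Sum>n. fps_nth f n * \<zeta> ^ n)" by (rule summable_sums)
    also have "(\<Sum>n. fps_nth f n * \<zeta> ^ n) = F \<zeta>"
      using eq[of \<zeta>] z by (simp add: borel_transform_def f_def)
    finally show ?thesis .
  qed
  then have "\<forall>\<^sub>F \<zeta> in nhds 0. (\<lambda>n. fps_nth f n * \<zeta> ^ n) sums F \<zeta>"
    by (intro eventually_nhds_in_open[THEN eventually_mono, of "ball 0 (min r (1/L))"]) (use r L in auto)
  then have "F has_fps_expansion f" by (rule has_fps_expansionI)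
  from fps_nth_fps_expansion[OF this, of n] show ?thesis by (simp add: f_def)
qed

section \<open>Stirling numbers and derivatives of functions of the logarithm\<close>

lemma stirling1_Suc:
  "stirling1 (Suc n) k = (if k = 0 then 0 else stirling1 n (k - 1)) - int n * stirling1 n k"
  by (cases k) (simp_all add: stirling1_def mult.commute[of _ "[:_, _:]"])

lemma stirling1_eq_0: "n < k \<Longrightarrow> stirling1 n k = 0"
proof (induction n arbitrary: k)
  case 0
  then show ?case by (simp add: stirling1_def)
next
  case (Suc n)
  then show ?case by (simp add: stirling1_Suc)
qed

text \<open>With \<open>s = exp x\<close> one has \<open>s\<^sup>n (d/ds)\<^sup>n = D (D - 1) \<dots> (D - n + 1)\<close> for \<open>D = d/dx\<close>.\<close>

lemma higher_deriv_compose_Ln: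
  assumes G: "G holomorphic_on T" and T: "open T" and S: "open S"
    and nS: "S \<inter> \<real>\<^sub>\<le>\<^sub>0 = {}" and ST: "Ln ` S \<subseteq> T" and s: "s \<in> S"
  shows "(deriv ^^ n) (\<lambda>s. G (Ln s)) s
           = (\<Sum>j\<le>n. of_int (stirling1 n j) * (deriv ^^ j) G (Ln s)) / s ^ n"
  using s
proof (induction n arbitrary: s)
  case 0
  then show ?case by (simp add: stirling1_def)
next
  case (Suc n)
  let ?c = "\<lambda>n j. of_int (stirling1 n j) :: complex"
  let ?G = "\<lambda>j. (deriv ^^ j) G (Ln s)"
  have s: "s \<in> S" "s \<notin> \<real>\<^sub>\<le>\<^sub>0" "s \<noteq> 0" "Ln s \<in> T" using Suc.prems nS ST by auto
  have dG: "((\<lambda>s. (deriv ^^ j) G (Ln s)) has_field_derivative ?G (Suc j) * (1 / s)) (at s)" for j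
  proof -
    have "((deriv ^^ j) G has_field_derivative ?G (Suc j)) (at (Ln s))"
      using holomorphic_derivI[OF holomorphic_higher_deriv[OF G T, of j] T s(4)] by simp
    from DERIV_chain2[OF this has_field_derivative_Ln[OF s(2)]] show ?thesis
      by (simp add: inverse_eq_divide)
  qed
  have D: "((\<lambda>s. (\<Sum>j\<le>n. ?c n j * (deriv ^^ j) G (Ln s)) / s ^ n) has_field_derivative
          (\<Sum>j\<le>n. ?c n j * ?G (Suc j)) / s ^ Suc n - of_nat n * (\<Sum>j\<le>n. ?c n j * ?G j) / s ^ Suc n) (at s)"
  proof -
    have sn: "s ^ n \<noteq> 0" using s by simp
    show ?thesis
      by (rule derivative_eq_intros dG refl sn)+
        (use s in \<open>cases n; simp add: field_simps sum_distrib_left sum_distrib_right sum_divide_distrib\<close>)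
  qed
  \<comment> \<open>The induction hypothesis holds on the open set \<open>S\<close>, hence near
    \<open>s\<close>, and may be differentiated.\<close>
  have "(deriv ^^ Suc n) (\<lambda>s. G (Ln s)) s = deriv (\<lambda>s. (\<Sum>j\<le>n. ?c n j * (deriv ^^ j) G (Ln s)) / s ^ n) s"
    using Suc.IH s(1) S by (auto intro!: deriv_cong_ev eventually_mono[OF eventually_nhds_in_open[of S]])
  also have "\<dots> = ((\<Sum>j\<le>n. ?c n j * ?G (Suc j)) - of_nat n * (\<Sum>j\<le>n. ?c n j * ?G j)) / s ^ Suc n"
    using DERIV_imp_deriv[OF D] by (simp add: diff_divide_distrib)
  also have "(\<Sum>j\<le>n. ?c n j * ?G (Suc j)) - of_nat n * (\<Sum>j\<le>n. ?c n j * ?G j)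
      = (\<Sum>j\<le>Suc n. ?c (Suc n) j * ?G j)"
  proof -
    \<comment> \<open>Both sums are brought to the range up to \<open>Suc n\<close>: one by a
      vanishing last coefficient, the other by an index shift whose new term at \<open>0\<close> is
      zero. The recurrence \<open>stirling1_Suc\<close> then applies termwise.\<close>
    have "(\<Sum>j\<le>n. ?c n j * ?G j) = (\<Sum>j\<le>Suc n. ?c n j * ?G j)"
      by (simp add: stirling1_eq_0)
    moreover have "(\<Sum>j\<le>n. ?c n j * ?G (Suc j)) = (\<Sum>j\<le>Suc n. (if j = 0 then 0 else ?c n (j - 1)) * ?G j)"
      by (subst sum.atMost_Suc_shift) simp
    ultimately show ?thesis
      by (simp only: sum_distrib_left sum_subtractf[symmetric])
        (auto intro!: sum.cong simp: stirling1_Suc algebra_simps simp del: funpow.simps)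
  qed
  finally show ?case .
qed

section \<open>Half-line integrals of exponentially decaying functions\<close>

lemma integrable_exp_decay:
  fixes f :: "real \<Rightarrow> 'a::euclidean_space"
  assumes cont: "continuous_on {0..} f" and d: "d > 0"
    and bd: "\<And>t. t \<ge> 0 \<Longrightarrow> norm (f t) \<le> C * exp (- d * t)"
  shows "f absolutely_integrable_on {0..}" "norm (integral {0..} f) \<le> C / d"
proof -
  have E: "((\<lambda>t. C * exp (- d * t)) has_integral C / d) {0..}"
    using has_integral_mult_right[OF has_integral_exp_minus_to_infinity[OF d, of 0], of C] by simp
  have m: "f \<in> borel_measurable (lebesgue_on {0..})"
    by (rule continuous_imp_measurable_on_sets_lebesgue[OF cont]) simp
  show ai: "f absolutely_integrable_on {0..}"
    by (rule measurable_bounded_by_integrable_imp_absolutely_integrable[OF m _ has_integral_integrable[OF E]])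
      (use bd in auto)
  have "norm (integral {0..} f) \<le> integral {0..} (\<lambda>t. C * exp (- d * t))"
    by (rule integral_norm_bound_integral)
      (use ai bd E in \<open>auto simp: absolutely_integrable_on_def has_integral_integrable\<close>)
  with integral_unique[OF E] show "norm (integral {0..} f) \<le> C / d" by simp
qed

text \<open>The form of the fundamental theorem behind every integration by parts below:
  \<open>f'\<close> is cut off at \<open>k\<close>, dominated convergence passes to the limit, and
  the decay of \<open>f\<close> removes the boundary term at infinity.\<close>

lemma has_integral_derivative_exp_decay:
  fixes f f' :: "real \<Rightarrow> 'a::euclidean_space"
  assumes der: "\<And>t. t \<ge> 0 \<Longrightarrow> (f has_vector_derivative f' t) (at t)"
    and cont: "continuous_on {0..} f'" and d: "d > 0"
    and bd': "\<And>t. t \<ge> 0 \<Longrightarrow> norm (f' t) \<le> C' * exp (- d * t)"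
    and bd: "\<And>t. t \<ge> 0 \<Longrightarrow> norm (f t) \<le> C * exp (- d * t)"
  shows "(f' has_integral - f 0) {0..}"
proof -
  have E: "(\<lambda>t. C' * exp (- d * t)) integrable_on {0..}"
    using has_integral_mult_right[OF has_integral_exp_minus_to_infinity[OF d, of 0], of C']
    by (auto simp: integrable_on_def)
  define g where "g k t = (if t \<in> {0..real k} then f' t else 0)" for k :: nat and t
  have ftc: "(f' has_integral f (real k) - f 0) {0..real k}" for k :: nat
    by (rule fundamental_theorem_of_calculus)
      (use der in \<open>auto intro: has_vector_derivative_at_within\<close>)
  have g: "(g k has_integral f (real k) - f 0) {0..}" for k
    unfolding g_def by (subst has_integral_restrict) (use ftc in auto)
  have lim: "(\<lambda>k. g k t) \<longlonglongrightarrow> f' t" if "t \<in> {0..}" for t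
  proof (rule tendsto_eventually)
    obtain k0 where "real k0 \<ge> t" using real_arch_simple by blast
    then show "\<forall>\<^sub>F k in sequentially. g k t = f' t"
      using that by (intro eventually_sequentiallyI[of k0]) (auto simp: g_def)
  qed
  have f0: "(\<lambda>k. f (real k)) \<longlonglongrightarrow> 0"
  proof (rule Lim_null_comparison)
    show "\<forall>\<^sub>F k in sequentially. norm (f (real k)) \<le> C * exp (- d * real k)"
      by (intro always_eventually allI bd) simp
    have "filterlim (\<lambda>k. - (d * real k)) at_bot sequentially"
      using d by (simp add: filterlim_uminus_at_bot filterlim_tendsto_pos_mult_at_top[OF tendsto_const] filterlim_real_sequentially)
    from filterlim_compose[OF exp_at_bot this]
    have "(\<lambda>k. exp (- d * real k)) \<longlonglongrightarrow> 0" by simp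
    from tendsto_mult_left[OF this, of C] show "(\<lambda>k. C * exp (- d * real k)) \<longlonglongrightarrow> 0" by simp
  qed
  have C': "0 \<le> C'" using order_trans[OF norm_ge_zero bd'[of 0]] by simp
  have le: "norm (g k t) \<le> C' * exp (- d * t)" if "t \<in> {0..}" for k t
    using bd'[of t] that C' by (simp add: g_def)
  have gi: "g k integrable_on {0..}" for k using g by (auto simp: integrable_on_def)
  have "(\<lambda>k. integral {0..} (g k)) \<longlonglongrightarrow> integral {0..} f'"
    by (rule dominated_convergence(2)[OF gi E le lim])
  moreover have "(\<lambda>k. integral {0..} (g k)) \<longlonglongrightarrow> 0 - f 0"
    using tendsto_diff[OF f0 tendsto_const[of "f 0"]] integral_unique[OF g] by simp
  ultimately have "integral {0..} f' = - f 0" using LIMSEQ_unique by fastforce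
  moreover have "f' integrable_on {0..}"
    by (rule dominated_convergence(1)[OF gi E le lim])
  ultimately show ?thesis by (metis integrable_integral)
qed

lemma norm_exp_of_real_mult: "norm (exp (- (z * of_real t))) = exp (- (Re z * t))" for z :: complex
  by (simp add: norm_exp_eq_Re)

text \<open>Under \<open>s = exp (- t / lam)\<close> this is \<open>lam\<close> times the Beta
  integral with parameters \<open>lam z\<close> and \<open>n + 1\<close>. The induction integrates
  by parts and passes from \<open>z\<close> to \<open>z + 1 / lam\<close>, so \<open>z\<close> has
  to be general.\<close>

lemma Beta_integral_exp:
  fixes z :: complex
  assumes lam: "lam > 0" and z: "Re z > 0"
  shows "((\<lambda>t::real. exp (- (z * of_real t)) * (1 - of_real (exp (- t / lam))) ^ n)
           has_integral of_real lam * fact n / pochhammer (of_real lam * z) (Suc n)) {0..}"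
  using z
proof (induction n arbitrary: z)
  case 0
  have z0: "z \<noteq> 0" using 0 by auto
  have "((\<lambda>t::real. exp (- (z * of_real t)) :: complex) has_integral - (- inverse z * exp (- (z * of_real 0)))) {0..}"
    by (rule has_integral_derivative_exp_decay[where C' = 1 and C = "norm (inverse z)" and d = "Re z"])
      (use 0 z0 in \<open>auto intro!: derivative_eq_intros has_vector_derivative_real_field continuous_intros
        simp: norm_mult norm_exp_of_real_mult simp del: norm_inverse\<close>)
  then show ?case using z0 lam by (simp add: field_simps)
next
  case (Suc n)
  define e where "e t = exp (- (z * of_real t))" for t :: real
  define u where "u t = (1 - of_real (exp (- t / lam)) :: complex)" for t :: real
  have z0: "z \<noteq> 0" using Suc by auto
  have e_exp: "exp (- ((z + of_real (1/lam)) * of_real t)) = e t * of_real (exp (- t / lam))" for t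
    by (simp add: e_def exp_add[symmetric] exp_of_real[symmetric] algebra_simps del: exp_of_real)
  \<comment> \<open>The factor \<open>exp (- t / lam)\<close> that differentiating \<open>u\<close>
    produces is absorbed by the shift to \<open>z + 1 / lam\<close>.\<close>
  have IH: "((\<lambda>t. e t * of_real (exp (- t / lam)) * u t ^ n)
           has_integral of_real lam * fact n / pochhammer (of_real lam * (z + of_real (1/lam))) (Suc n)) {0..}"
    using Suc.IH[of "z + of_real (1/lam)"] Suc.prems lam unfolding e_exp u_def[symmetric] by (simp add: add_pos_pos)
  have nu: "norm (u t) \<le> 1" if "t \<ge> 0" for t
  proof -
    have "u t = of_real (1 - exp (- t / lam))" by (simp add: u_def)
    moreover have "exp (- t / lam) \<le> 1" using that lam by simp
    ultimately show ?thesis by (simp add: norm_of_real del: of_real_diff)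
  qed
  have nup: "norm (u t) ^ k \<le> 1" if "t \<ge> 0" for t k
    using nu[OF that] by (simp add: power_le_one)
  have ne: "norm (e t) = exp (- Re z * t)" for t by (simp add: e_def norm_exp_of_real_mult)
  have du: "(u has_vector_derivative of_real (exp (- t / lam) / lam)) (at t)" for t
  proof -
    have "((\<lambda>t. exp (- t / lam)) has_real_derivative - (exp (- t / lam) / lam)) (at t)"
      using lam by (auto intro!: derivative_eq_intros)
    from has_vector_derivative_diff[OF has_vector_derivative_const[of 1] has_vector_derivative_of_real[OF this, where 'a = complex]]
    show ?thesis by (simp add: u_def[abs_def])
  qed
  have de: "(e has_vector_derivative - z * e t) (at t)" for t
    unfolding e_def by (auto intro!: derivative_eq_intros has_vector_derivative_real_field)
  have dup: "((\<lambda>t. u t ^ Suc n) has_vector_derivative of_real (exp (- t / lam) / lam) * (of_nat (Suc n) * u t ^ n)) (at t)" for t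
  proof -
    have "((\<lambda>x. x ^ Suc n) has_field_derivative (of_nat (Suc n) * u t ^ n)) (at (u t))"
      by (rule derivative_eq_intros refl | simp)+
    from field_vector_diff_chain_at[OF du this] show ?thesis by (simp add: o_def)
  qed
  define f' where "f' t = e t * (of_real (exp (- t / lam) / lam) * (of_nat (Suc n) * u t ^ n)) + - z * e t * u t ^ Suc n" for t
  have cu: "continuous_on A u" and ce: "continuous_on A e" for A
    unfolding u_def e_def using lam by (auto intro!: continuous_intros)
  have dd: "((\<lambda>t. e t * u t ^ Suc n) has_vector_derivative f' t) (at t)" for t
    unfolding f'_def by (rule has_vector_derivative_mult[OF de dup])
  have I1: "(f' has_integral - (e 0 * u 0 ^ Suc n)) {0..}"
  proof (rule has_integral_derivative_exp_decay[where d = "Re z" and C = 1 and C' = "real (Suc n) / lam + norm z"])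
    show "continuous_on {0..} f'"
      unfolding f'_def using lam by (intro continuous_intros cu ce) auto
    show "norm (e t * u t ^ Suc n) \<le> 1 * exp (- Re z * t)" if "t \<ge> 0" for t
      using nup[OF that, of "Suc n"] by (simp add: norm_mult norm_power ne mult_left_le del: power_Suc)
    show "norm (f' t) \<le> (real (Suc n) / lam + norm z) * exp (- Re z * t)" if t: "t \<ge> 0" for t
    proof -
      have ex: "exp (- t / lam) \<le> 1" using t lam by simp
      have "norm (f' t) \<le> norm (e t) * (exp (- t / lam) / lam * (real (Suc n) * norm (u t) ^ n)) + norm z * norm (e t) * norm (u t) ^ Suc n"
        unfolding f'_def by (rule order_trans[OF norm_triangle_ineq]) (use lam in \<open>simp add: norm_mult norm_power norm_divide del: of_nat_Suc power_Suc\<close>)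
      also have "\<dots> \<le> norm (e t) * (1 / lam * (real (Suc n) * 1)) + norm z * norm (e t) * 1"
        by (intro add_mono mult_left_mono mult_mono divide_right_mono nup t ex) (use lam in auto)
      finally show ?thesis by (simp add: ne algebra_simps add_divide_distrib)
    qed
  qed (use dd Suc.prems in auto)
  \<comment> \<open>The formula for \<open>f'\<close> is solved for
    \<open>e t * u t ^ Suc n\<close>. The integral of \<open>f'\<close> vanishes because
    \<open>u 0 = 0\<close>.\<close>
  have "((\<lambda>t. inverse z * (of_nat (Suc n) / of_real lam * (e t * of_real (exp (- t / lam)) * u t ^ n) - f' t)) has_integral
     inverse z * (of_nat (Suc n) / of_real lam * (of_real lam * fact n / pochhammer (of_real lam * (z + of_real (1/lam))) (Suc n)) - (- (e 0 * u 0 ^ Suc n)))) {0..}"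
    by (intro has_integral_mult_right has_integral_diff IH I1)
  moreover have "inverse z * (of_nat (Suc n) / of_real lam * (e t * of_real (exp (- t / lam)) * u t ^ n) - f' t) = e t * u t ^ Suc n" for t
    unfolding f'_def using z0 lam by (simp add: field_simps)
  moreover have "inverse z * (of_nat (Suc n) / of_real lam * (of_real lam * fact n / pochhammer (of_real lam * (z + of_real (1/lam))) (Suc n)) - (- (e 0 * u 0 ^ Suc n)))
     = of_real lam * fact (Suc n) / pochhammer (of_real lam * z) (Suc (Suc n))"
  proof -
    define p where "p = pochhammer (of_real lam * z + 1) (Suc n)"
    have "pochhammer (of_real lam * z) (Suc (Suc n)) = of_real lam * z * p"
      unfolding p_def by (rule pochhammer_rec)
    moreover have "of_real lam * (z + of_real (1/lam)) = of_real lam * z + 1" using lam by (simp add: field_simps)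
    then have "pochhammer (of_real lam * (z + of_real (1/lam))) (Suc n) = p" by (simp only: p_def)
    moreover have "u 0 = 0" by (simp add: u_def)
    ultimately show ?thesis using z0 lam
      by (simp only: fact_Suc of_nat_mult) (simp add: divide_simps)
  qed
  ultimately show ?case by (simp add: e_def u_def)
qed

section \<open>Remainder integrals for a function of logarithmic growth on the disc\<close>

text \<open>The growth condition is the bound \<open>A * exp (B * norm \<zeta>)\<close> carried over
  by \<open>\<zeta> = - lam * Ln s\<close>, with \<open>c = lam * B\<close>.\<close>

locale log_growth =
  fixes h :: "complex \<Rightarrow> complex" and A c :: real
  assumes hol: "h holomorphic_on ball 1 1"
    and A_nonneg: "A \<ge> 0" and c_nonneg: "c \<ge> 0"
    and growth: "\<And>s. s \<in> ball 1 1 \<Longrightarrow> norm (h s) \<le> A * exp (c * norm (Ln s))"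
begin

text \<open>Cauchy's estimate on the circle of radius \<open>\<rho> s\<close> about \<open>s\<close>, on which
  \<open>|Ln| \<le> - ln s - ln (1 - \<rho>)\<close>.\<close>

lemma norm_higher_deriv_le:
  assumes s: "0 < s" "s \<le> 1" and r: "0 < \<rho>" "\<rho> < 1"
  shows "norm ((deriv ^^ n) h (of_real s)) \<le> fact n * (A * (s * (1 - \<rho>)) powr (- c)) / (\<rho> * s) ^ n"
proof (rule Cauchy_inequality)
  have rs: "\<rho> * s < s" using s r by simp
  have sub: "cball (of_real s) (\<rho> * s) \<subseteq> ball (1::complex) 1"
  proof
    fix x :: complex assume "x \<in> cball (of_real s) (\<rho> * s)"
    then have "dist (of_real s) x \<le> \<rho> * s" by simp
    moreover have "dist 1 (of_real s :: complex) = 1 - s"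
      using s by (metis abs_of_nonneg diff_ge_0_iff_ge dist_norm norm_of_real of_real_1 of_real_diff)
    ultimately show "x \<in> ball 1 1"
      using dist_triangle[of 1 x "of_real s"] rs by simp
  qed
  show "h holomorphic_on ball (of_real s) (\<rho> * s)"
    by (rule holomorphic_on_subset[OF hol]) (use sub ball_subset_cball in blast)
  show "continuous_on (cball (of_real s) (\<rho> * s)) h"
    by (rule continuous_on_subset[OF holomorphic_on_imp_continuous_on[OF hol] sub])
  show "0 < \<rho> * s" using s r by simp
  fix x :: complex assume x: "norm (of_real s - x) = \<rho> * s"
  define u where "u = (x - of_real s) / of_real s"
  have nu: "norm u = \<rho>" using x s by (simp add: u_def norm_divide norm_minus_commute)
  have xu: "x = of_real s * (1 + u)" using s by (simp add: u_def field_simps)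
  have u1: "1 + u \<noteq> 0"
  proof
    assume "1 + u = 0"
    then have "u = -1" by (simp add: eq_neg_iff_add_eq_0 add.commute)
    then show False using nu r by simp
  qed
  \<comment> \<open>The factor \<open>s\<close> is a positive real, so the principal logarithm
    splits without a branch correction.\<close>
  have "Ln x = of_real (ln s) + Ln (1 + u)"
    using Ln_times_of_real[OF s(1) u1] s xu by (simp add: Ln_of_real)
  then have "norm (Ln x) \<le> \<bar>ln s\<bar> + norm (Ln (1 + u))"
    by (metis norm_triangle_ineq norm_of_real)
  also have "\<dots> \<le> - ln s + - ln (1 - \<rho>)"
    using norm_Ln_one_plus_le[of u] nu r s by simp
  also have "\<dots> = - ln (s * (1 - \<rho>))"
    using s r by (simp add: ln_mult)
  finally have L: "norm (Ln x) \<le> - ln (s * (1 - \<rho>))" .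
  have "x \<in> ball 1 1" using sub x by (auto simp: dist_norm subset_iff)
  then have "norm (h x) \<le> A * exp (c * norm (Ln x))" by (rule growth)
  also have "\<dots> \<le> A * exp (c * (- ln (s * (1 - \<rho>))))"
    using A_nonneg c_nonneg by (intro mult_left_mono L iffD2[OF exp_le_cancel_iff]) auto
  also have "\<dots> = A * (s * (1 - \<rho>)) powr (- c)"
    using s r by (simp add: powr_def)
  finally show "norm (h x) \<le> A * (s * (1 - \<rho>)) powr (- c)" .
qed

text \<open>The integrand \<open>s powr (lam z + n - 1) * (deriv ^^ n) h s\<close> of the \<open>n\<close>-th remainder, in the
  variable \<open>t = - lam ln s\<close>.\<close>

definition rem_integrand :: "real \<Rightarrow> complex \<Rightarrow> nat \<Rightarrow> real \<Rightarrow> complex" where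
  "rem_integrand lam z n t = exp (- ((z + of_real (real n / lam)) * of_real t)) * (deriv ^^ n) h (of_real (exp (- t / lam)))"

lemma exp_in_ball: "lam > 0 \<Longrightarrow> t \<ge> 0 \<Longrightarrow> (of_real (exp (- t / lam)) :: complex) \<in> ball 1 1"
proof -
  assume "lam > 0" "t \<ge> 0"
  then have "exp (- t / lam) \<le> 1" by simp
  moreover have "dist 1 (of_real (exp (- t / lam)) :: complex) = \<bar>1 - exp (- t / lam)\<bar>"
    by (metis dist_norm norm_of_real of_real_1 of_real_diff real_norm_def)
  ultimately show ?thesis by simp
qed

text \<open>The power \<open>s ^ n\<close> lost in Cauchy's estimate is cancelled by the weight
  \<open>exp (- n t / lam)\<close>, so the decay rate is the same for all \<open>n\<close>; only
  \<open>s powr (- c)\<close> remains and lowers it by \<open>c / lam\<close>.\<close>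

lemma norm_rem_integrand_le:
  assumes lam: "lam > 0" and t: "t \<ge> 0" and r: "0 < \<rho>" "\<rho> < 1"
  shows "norm (rem_integrand lam z n t) \<le> fact n * A * (1 - \<rho>) powr (- c) / \<rho> ^ n * exp (- (Re z - c / lam) * t)"
proof -
  define s where "s = exp (- t / lam)"
  have s: "0 < s" "s \<le> 1" using lam t by (auto simp: s_def)
  have "norm (rem_integrand lam z n t) = exp (- ((Re z + real n / lam) * t)) * norm ((deriv ^^ n) h (of_real s))"
    by (simp add: rem_integrand_def norm_mult norm_exp_of_real_mult s_def)
  also have "\<dots> \<le> exp (- ((Re z + real n / lam) * t)) * (fact n * (A * (s * (1 - \<rho>)) powr (- c)) / (\<rho> * s) ^ n)"
    by (intro mult_left_mono norm_higher_deriv_le s r) simp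
  also have "(s * (1 - \<rho>)) powr (- c) = exp (c / lam * t) * (1 - \<rho>) powr (- c)"
    using s r by (simp add: powr_mult) (simp add: s_def powr_def)
  also have "(\<rho> * s) ^ n = \<rho> ^ n / exp (real n / lam * t)"
  proof -
    have "s ^ n = exp (real n * (- t / lam))" by (simp only: s_def exp_of_nat_mult)
    then show ?thesis by (simp add: power_mult_distrib exp_minus field_simps)
  qed
  also have "exp (- ((Re z + real n / lam) * t)) * (fact n * (A * (exp (c / lam * t) * (1 - \<rho>) powr - c)) / (\<rho> ^ n / exp (real n / lam * t)))
     = fact n * A * (1 - \<rho>) powr (- c) / \<rho> ^ n * (exp (- ((Re z + real n / lam) * t)) * exp (c / lam * t) * exp (real n / lam * t))"
    by simp
  also have "exp (- ((Re z + real n / lam) * t)) * exp (c / lam * t) * exp (real n / lam * t) = exp (- (Re z - c / lam) * t)"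
    by (simp add: exp_add[symmetric] algebra_simps)
  finally show ?thesis .
qed

text \<open>The chain rule for \<open>s = exp (- t / lam)\<close> yields \<open>- s / lam\<close>;
  the exponential weight absorbs this \<open>s\<close>, which turns index \<open>n\<close> into
  \<open>Suc n\<close>.\<close>

lemma has_vector_derivative_rem_integrand:
  assumes lam: "lam > 0" and t: "t \<ge> 0"
  shows "(rem_integrand lam z n has_vector_derivative
           - (z + of_real (real n / lam)) * rem_integrand lam z n t - of_real (1 / lam) * rem_integrand lam z (Suc n) t) (at t)"
proof -
  define s where "s t = (of_real (exp (- t / lam)) :: complex)" for t :: real
  define e where "e t = exp (- ((z + of_real (real n / lam)) * of_real t))" for t :: real
  have ds: "(s has_vector_derivative - of_real (1 / lam) * s t) (at t)"
  proof -
    have "((\<lambda>t. exp (- t / lam)) has_real_derivative - (1 / lam) * exp (- t / lam)) (at t)"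
      using lam by (auto intro!: derivative_eq_intros)
    from has_vector_derivative_of_real[OF this, where 'a = complex]
    show ?thesis by (simp add: s_def[abs_def])
  qed
  have de: "(e has_vector_derivative - (z + of_real (real n / lam)) * e t) (at t)"
    unfolding e_def by (auto intro!: derivative_eq_intros has_vector_derivative_real_field)
  have "((deriv ^^ n) h has_field_derivative (deriv ^^ Suc n) h (s t)) (at (s t))"
    using holomorphic_derivI[OF holomorphic_higher_deriv[OF hol open_ball] open_ball exp_in_ball[OF lam t]]
    by (simp add: s_def)
  from has_vector_derivative_mult[OF de field_vector_diff_chain_at[OF ds this]]
  have "((\<lambda>t. e t * (deriv ^^ n) h (s t)) has_vector_derivative
       e t * (- of_real (1 / lam) * s t * (deriv ^^ Suc n) h (s t))
         + - (z + of_real (real n / lam)) * e t * (deriv ^^ n) h (s t)) (at t)"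
    by (simp add: o_def)
  moreover have "rem_integrand lam z n = (\<lambda>t. e t * (deriv ^^ n) h (s t))"
    by (simp add: rem_integrand_def e_def s_def fun_eq_iff)
  moreover have "rem_integrand lam z (Suc n) t = e t * s t * (deriv ^^ Suc n) h (s t)"
  proof -
    have "exp (- ((z + of_real (real (Suc n) / lam)) * of_real t)) = e t * s t"
      by (simp add: e_def s_def exp_add[symmetric] exp_of_real[symmetric] algebra_simps add_divide_distrib del: exp_of_real)
    then show ?thesis by (simp add: rem_integrand_def s_def)
  qed
  ultimately show ?thesis by (simp add: algebra_simps)
qed

lemma continuous_on_rem_integrand: "lam > 0 \<Longrightarrow> continuous_on {0..} (rem_integrand lam z n)"
  using has_vector_derivative_rem_integrand[THEN has_vector_derivative_continuous]
  by (auto intro!: continuous_at_imp_continuous_on)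

context
  fixes lam :: real and z :: complex
  assumes lam: "lam > 0" and z: "Re z > c / lam"
begin

lemma rem_integrand_absolutely_integrable: "rem_integrand lam z n absolutely_integrable_on {0..}"
  \<comment> \<open>Every \<open>\<rho>\<close> strictly between \<open>0\<close> and
    \<open>1\<close> gives integrability; its value matters only for the final error bound.\<close>
  by (rule integrable_exp_decay(1)[OF continuous_on_rem_integrand[OF lam] _ norm_rem_integrand_le[OF lam, where \<rho> = "1/2"]])
    (use z in auto)

lemma norm_integral_rem_integrand_le:
  assumes "0 < \<rho>" "\<rho> < 1"
  shows "norm (integral {0..} (rem_integrand lam z n)) \<le> fact n * A * (1 - \<rho>) powr (- c) / \<rho> ^ n / (Re z - c / lam)"
  by (rule integrable_exp_decay(2)[OF continuous_on_rem_integrand[OF lam] _ norm_rem_integrand_le[OF lam]])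
    (use z assms in auto)

text \<open>One integration by parts. The derivative of the integrand is integrated in two ways, by
  its boundary value at \<open>t = 0\<close>, that is \<open>s = 1\<close>, and by
  linearity.\<close>

lemma integral_rem_integrand_rec:
  "(of_real lam * z + of_nat n) * integral {0..} (rem_integrand lam z n)
     = of_real lam * (deriv ^^ n) h 1 - integral {0..} (rem_integrand lam z (Suc n))"
proof -
  define M where "M n = fact n * A * (1 - 1/2) powr (- c) / (1/2) ^ n" for n :: nat
  have Kb: "norm (rem_integrand lam z n t) \<le> M n * exp (- (Re z - c / lam) * t)" if "t \<ge> 0" for n t
    using norm_rem_integrand_le[OF lam that, of "1/2" z n] unfolding M_def by simp
  have "((\<lambda>t. - (z + of_real (real n / lam)) * rem_integrand lam z n t - of_real (1 / lam) * rem_integrand lam z (Suc n) t) has_integral - rem_integrand lam z n 0) {0..}"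
  proof (rule has_integral_derivative_exp_decay[OF has_vector_derivative_rem_integrand[OF lam] _ _ _ Kb])
    show "continuous_on {0..} (\<lambda>t. - (z + of_real (real n / lam)) * rem_integrand lam z n t - of_real (1 / lam) * rem_integrand lam z (Suc n) t)"
      by (intro continuous_intros continuous_on_rem_integrand lam)
    fix t :: real assume t: "t \<ge> 0"
    have "norm (- (z + of_real (real n / lam)) * rem_integrand lam z n t - of_real (1 / lam) * rem_integrand lam z (Suc n) t)
      \<le> norm (z + of_real (real n / lam)) * norm (rem_integrand lam z n t) + norm (of_real (1 / lam) :: complex) * norm (rem_integrand lam z (Suc n) t)"
      by (rule order_trans[OF norm_triangle_ineq4]) (simp add: norm_mult norm_minus_commute del: of_real_divide add_uminus_conv_diff minus_add_distrib norm_of_real)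
    also have "\<dots> \<le> norm (z + of_real (real n / lam)) * (M n * exp (- (Re z - c / lam) * t)) + norm (of_real (1 / lam) :: complex) * (M (Suc n) * exp (- (Re z - c / lam) * t))"
      by (intro add_mono mult_left_mono Kb t) auto
    finally show "norm (- (z + of_real (real n / lam)) * rem_integrand lam z n t - of_real (1 / lam) * rem_integrand lam z (Suc n) t)
      \<le> (norm (z + of_real (real n / lam)) * M n + norm (of_real (1 / lam) :: complex) * M (Suc n)) * exp (- (Re z - c / lam) * t)"
      by (simp add: algebra_simps)
  qed (use z in auto)
  moreover have "((\<lambda>t. - (z + of_real (real n / lam)) * rem_integrand lam z n t - of_real (1 / lam) * rem_integrand lam z (Suc n) t) has_integral
     - (z + of_real (real n / lam)) * integral {0..} (rem_integrand lam z n) - of_real (1 / lam) * integral {0..} (rem_integrand lam z (Suc n))) {0..}"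
    by (intro has_integral_diff has_integral_mult_right integrable_integral)
      (use rem_integrand_absolutely_integrable in \<open>auto simp: absolutely_integrable_on_def\<close>)
  ultimately have "- rem_integrand lam z n 0 = - (z + of_real (real n / lam)) * integral {0..} (rem_integrand lam z n) - of_real (1 / lam) * integral {0..} (rem_integrand lam z (Suc n))"
    by (rule has_integral_unique)
  moreover have "rem_integrand lam z n 0 = (deriv ^^ n) h 1" by (simp add: rem_integrand_def)
  ultimately have "(z + of_real (real n / lam)) * integral {0..} (rem_integrand lam z n)
      = (deriv ^^ n) h 1 - of_real (1 / lam) * integral {0..} (rem_integrand lam z (Suc n))"
    by (simp add: algebra_simps)
  then have "of_real lam * ((z + of_real (real n / lam)) * integral {0..} (rem_integrand lam z n))
      = of_real lam * ((deriv ^^ n) h 1 - of_real (1 / lam) * integral {0..} (rem_integrand lam z (Suc n)))"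
    by simp
  then show ?thesis using lam by (simp add: algebra_simps)
qed

lemma Re_pos: "Re z > 0"
  using z lam c_nonneg by (smt (verit) divide_nonneg_pos)

lemma pochhammer_neq_0: "pochhammer (of_real lam * z) n \<noteq> 0"
proof -
  have "Re (of_real lam * z + of_nat k) > 0" for k
    using Re_pos lam by (simp add: add_pos_nonneg)
  then have "of_real lam * z + of_nat k \<noteq> 0" for k by (metis less_irrefl zero_complex.sel(1))
  then show ?thesis by (auto simp: pochhammer_eq_0_iff eq_neg_iff_add_eq_0)
qed

text \<open>Iterates \<open>integral_rem_integrand_rec\<close>: each use splits off one term of the
  factorial series and divides the remainder by \<open>- (lam z + N)\<close>, which builds up the
  Pochhammer symbol.\<close>

lemma integral_rem_integrand_expansion:
  "integral {0..} (rem_integrand lam z 0)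
     = of_real lam * (\<Sum>n<N. (- 1) ^ n * (deriv ^^ n) h 1 / pochhammer (of_real lam * z) (Suc n))
       + (- 1) ^ N / pochhammer (of_real lam * z) N * integral {0..} (rem_integrand lam z N)"
proof (induction N)
  case 0
  show ?case by simp
next
  case (Suc N)
  let ?p = "pochhammer (of_real lam * z)"
  have "?p (Suc N) = ?p N * (of_real lam * z + of_nat N)" by (rule pochhammer_Suc)
  moreover have "?p N \<noteq> 0" "?p (Suc N) \<noteq> 0" by (rule pochhammer_neq_0)+
  ultimately have "(- 1) ^ N / ?p N * integral {0..} (rem_integrand lam z N)
     = (- 1) ^ N / ?p (Suc N) * ((of_real lam * z + of_nat N) * integral {0..} (rem_integrand lam z N))"
    by (simp add: field_simps)
  also have "\<dots> = (- 1) ^ N / ?p (Suc N) * (of_real lam * (deriv ^^ N) h 1 - integral {0..} (rem_integrand lam z (Suc N)))"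
    by (simp only: integral_rem_integrand_rec)
  finally show ?case using Suc.IH by (simp add: algebra_simps)
qed

end
end

section \<open>Taylor coefficients at \<open>1\<close> from an integral estimate on circles\<close>

text \<open>The circle of radius \<open>r\<close> about \<open>1\<close> is nearest to the possible
  singularity \<open>0\<close> at \<open>t = 1/2\<close>. With \<open>y\<close> the distance of
  \<open>t\<close> to \<open>1/2\<close>, the squared modulus is
  \<open>(1 - r)\<^sup>2 + 4 * r * (sin (pi * y))\<^sup>2\<close>, and \<open>sin_ge_chord\<close>
  makes the second term quadratic in \<open>y\<close>.\<close>

lemma norm_circle_ge:
  fixes r t :: real
  assumes r: "1/2 \<le> r" "r \<le> 1" and t: "0 \<le> t" "t \<le> 1"
  shows "(1 - r + \<bar>t - 1/2\<bar>) / 2 \<le> norm (1 + of_real r * exp (2 * of_real pi * \<i> * of_real t))"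
proof -
  define y where "y = \<bar>t - 1/2\<bar>"
  have y: "0 \<le> y" "y \<le> 1/2" using t by (auto simp: y_def abs_if)
  have e: "exp (2 * of_real pi * \<i> * of_real t) = cis (2 * pi * t)"
    by (simp add: cis_conv_exp mult_ac)
  have "cos (2 * pi * t) = - cos (2 * (pi * (t - 1/2)))"
  proof -
    have "2 * pi * t = 2 * (pi * (t - 1/2)) + pi" by (simp add: algebra_simps)
    then show ?thesis by (simp only: cos_periodic_pi)
  qed
  also have "cos (2 * (pi * (t - 1/2))) = cos (2 * (pi * y))"
    unfolding y_def by (metis abs_mult abs_numeral abs_of_pos cos_abs_real pi_gt_zero)
  also have "- cos (2 * (pi * y)) = 2 * (sin (pi * y))\<^sup>2 - 1"
    by (simp add: cos_double_sin)
  finally have cos: "cos (2 * pi * t) = 2 * (sin (pi * y))\<^sup>2 - 1" .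
  have "(norm (1 + of_real r * cis (2 * pi * t)))\<^sup>2 = 1 + r\<^sup>2 + 2 * r * cos (2 * pi * t)"
  proof -
    have "(norm (1 + of_real r * cis (2 * pi * t)))\<^sup>2 = (1 + r * cos (2 * pi * t))\<^sup>2 + (r * sin (2 * pi * t))\<^sup>2"
      by (simp add: cmod_power2)
    also have "\<dots> = 1 + 2 * r * cos (2 * pi * t) + r\<^sup>2 * ((cos (2 * pi * t))\<^sup>2 + (sin (2 * pi * t))\<^sup>2)"
      by algebra
    finally show ?thesis by simp
  qed
  also have "\<dots> = (1 - r)\<^sup>2 + 4 * r * (sin (pi * y))\<^sup>2"
    by (subst cos) (simp add: power2_eq_square algebra_simps)
  also have "\<dots> \<ge> (1 - r)\<^sup>2 + 2 * (2 * y)\<^sup>2"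
  proof -
    have "(2 * y)\<^sup>2 \<le> (sin (pi * y))\<^sup>2"
      by (rule power_mono[OF sin_ge_chord[OF y]]) (use y in simp)
    moreover have "2 * (sin (pi * y))\<^sup>2 \<le> 4 * r * (sin (pi * y))\<^sup>2"
      using r by (intro mult_right_mono) auto
    ultimately show ?thesis by simp
  qed
  finally have N: "(norm (1 + of_real r * cis (2 * pi * t)))\<^sup>2 \<ge> (1 - r)\<^sup>2 + 2 * (2 * y)\<^sup>2" .
  have "((1 - r + y) / 2)\<^sup>2 \<le> (1 - r)\<^sup>2 + 2 * (2 * y)\<^sup>2"
  proof -
    \<comment> \<open>The constant \<open>1/2\<close> in the claim is generous: the difference is a
      sum of squares.\<close>
    have "u\<^sup>2 + 2 * (2 * y)\<^sup>2 - ((u + y) / 2)\<^sup>2 = ((u - y)\<^sup>2 + 2 * u\<^sup>2 + 30 * y\<^sup>2) / 4" for u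
      by (simp add: power2_eq_square field_simps)
    moreover have "0 \<le> ((u - y)\<^sup>2 + 2 * u\<^sup>2 + 30 * y\<^sup>2) / 4" for u by simp
    ultimately show ?thesis by (metis diff_ge_0_iff_ge)
  qed
  with N have "((1 - r + y) / 2)\<^sup>2 \<le> (norm (1 + of_real r * cis (2 * pi * t)))\<^sup>2" by linarith
  then have "(1 - r + y) / 2 \<le> norm (1 + of_real r * cis (2 * pi * t))"
    by (rule power2_le_imp_le) simp
  then show ?thesis by (simp add: e y_def)
qed

text \<open>The integral has order \<open>d powr (1 - b)\<close>, while the supremum of the
  integrand is \<open>d powr (- b)\<close>; for \<open>d = 1 / (n + 1)\<close> this is the saved
  factor \<open>n\<close>.\<close>

lemma powr_kernel_integral_le:
  fixes d b :: real
  assumes d: "d > 0" and b: "b > 1"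
  shows "(\<lambda>t. (d + \<bar>t - 1/2\<bar>) powr (- b)) integrable_on {0..1}"
    and "integral {0..1} (\<lambda>t. (d + \<bar>t - 1/2\<bar>) powr (- b)) \<le> 2 * d powr (1 - b) / (b - 1)"
proof -
  let ?e = "(d + 1/2) powr (1 - b) / (1 - b)" and ?d = "d powr (1 - b) / (1 - b)"
  have "((\<lambda>t. (d + (1/2 - t)) powr (- b)) has_integral
          - ((d + (1/2 - 1/2)) powr (1 - b) / (1 - b)) - - ((d + (1/2 - 0)) powr (1 - b) / (1 - b))) {0..1/2}"
    by (rule fundamental_theorem_of_calculus)
      (use d b in \<open>auto intro!: derivative_eq_intros simp: has_real_derivative_iff_has_vector_derivative[symmetric]\<close>)
  then have l: "((\<lambda>t. (d + \<bar>t - 1/2\<bar>) powr (- b)) has_integral - ?d + ?e) {0..1/2}"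
    by (rule has_integral_eq[rotated, THEN has_integral_eq_rhs]) auto
  have "((\<lambda>t. (d + (t - 1/2)) powr (- b)) has_integral
          (d + (1 - 1/2)) powr (1 - b) / (1 - b) - (d + (1/2 - 1/2)) powr (1 - b) / (1 - b)) {1/2..1}"
    by (rule fundamental_theorem_of_calculus)
      (use d b in \<open>auto intro!: derivative_eq_intros simp: has_real_derivative_iff_has_vector_derivative[symmetric]\<close>)
  then have u: "((\<lambda>t. (d + \<bar>t - 1/2\<bar>) powr (- b)) has_integral ?e - ?d) {1/2..1}"
    by (rule has_integral_eq[rotated, THEN has_integral_eq_rhs]) auto
  have I: "((\<lambda>t. (d + \<bar>t - 1/2\<bar>) powr (- b)) has_integral (- ?d + ?e) + (?e - ?d)) {0..1}"
    by (rule has_integral_combine[OF _ _ l u]) auto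
  then show "(\<lambda>t. (d + \<bar>t - 1/2\<bar>) powr (- b)) integrable_on {0..1}" by blast
  \<comment> \<open>The contributions of the endpoints \<open>0\<close> and \<open>1\<close> are
    dropped; their sign is favourable because \<open>b > 1\<close>.\<close>
  have "?e \<le> 0" using b by (simp add: divide_nonneg_neg)
  moreover have "- ?d = d powr (1 - b) / (b - 1)" using b by (simp add: field_simps)
  ultimately show "integral {0..1} (\<lambda>t. (d + \<bar>t - 1/2\<bar>) powr (- b)) \<le> 2 * d powr (1 - b) / (b - 1)"
    using integral_unique[OF I] by simp
qed

context log_growth
begin

text \<open>On the disc \<open>norm (Ln s)\<close> exceeds \<open>- ln (norm s)\<close> by a bounded
  amount only, since \<open>norm s < 2\<close> and the argument is at most \<open>pi\<close>.
  Enlarging the exponent from \<open>c\<close> to \<open>b\<close> costs a factor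
  \<open>2 powr (b - c)\<close> and makes \<open>b > 1\<close> possible.\<close>

lemma growth_powr:
  assumes b: "b \<ge> c"
  obtains M where "M \<ge> 0" "\<And>s. s \<in> ball 1 1 \<Longrightarrow> norm (h s) \<le> M * norm s powr (- b)"
proof
  define M where "M = A * exp (c * (2 * ln 2 + pi)) * 2 powr (b - c)"
  show "M \<ge> 0" using A_nonneg by (simp add: M_def)
  fix s :: complex assume s: "s \<in> ball 1 1"
  define q where "q = norm s"
  have s0: "s \<noteq> 0" using s by auto
  then have q0: "q > 0" by (simp add: q_def)
  have q2: "q < 2" using s norm_triangle_sub[of s 1] by (simp add: q_def dist_norm norm_minus_commute)
  have lq: "ln q \<le> ln 2" using q0 q2 by simp
  have l2: "ln (2::real) \<ge> 0" by simp
  have "norm (Ln s) \<le> \<bar>Re (Ln s)\<bar> + \<bar>Im (Ln s)\<bar>" by (rule cmod_le)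
  also have "\<dots> \<le> \<bar>ln q\<bar> + pi"
    using Im_Ln_le_pi[OF s0] mpi_less_Im_Ln[OF s0] s0 by (simp add: q_def)
  also have "\<dots> \<le> - ln q + (2 * ln 2 + pi)" using lq l2 by linarith
  finally have L: "norm (Ln s) \<le> - ln q + (2 * ln 2 + pi)" .
  have "norm (h s) \<le> A * exp (c * norm (Ln s))" by (rule growth[OF s])
  also have "\<dots> \<le> A * exp (c * (- ln q + (2 * ln 2 + pi)))"
    using A_nonneg c_nonneg by (intro mult_left_mono L iffD2[OF exp_le_cancel_iff]) auto
  also have "\<dots> = A * exp (c * (2 * ln 2 + pi)) * q powr (- c)"
    using q0 by (simp add: powr_def exp_add[symmetric] algebra_simps)
  also have "\<dots> \<le> A * exp (c * (2 * ln 2 + pi)) * (2 powr (b - c) * q powr (- b))"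
  proof (intro mult_left_mono)
    have "q powr (- c) = q powr (b - c) * q powr (- b)"
      by (simp add: powr_add[symmetric])
    also have "\<dots> \<le> 2 powr (b - c) * q powr (- b)"
      using q0 q2 b by (intro mult_right_mono powr_mono2) auto
    finally show "q powr (- c) \<le> 2 powr (b - c) * q powr (- b)" .
  qed (use A_nonneg in auto)
  finally show "norm (h s) \<le> M * norm s powr (- b)" by (simp add: M_def q_def)
qed

text \<open>The sup-norm Cauchy estimate loses a factor \<open>n\<close>; integrating the growth bound
  over the circle of radius \<open>n / (n + 1)\<close> about \<open>1\<close> recovers it.\<close>

lemma taylor_coeff_bound:
  assumes b: "b \<ge> c" "b > 1"
  obtains C where "\<And>n. norm ((deriv ^^ n) h 1) / fact n \<le> C * (real n + 1) powr (b - 1)"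
proof -
  obtain M where M: "M \<ge> 0" "\<And>s. s \<in> ball 1 1 \<Longrightarrow> norm (h s) \<le> M * norm s powr (- b)"
    using growth_powr[OF b(1)] by blast
  define C where "C = exp 1 * M * 2 powr b * (2 / (b - 1))"
  \<comment> \<open>For \<open>n = 0\<close> the radius would degenerate to \<open>0\<close>; that
    case enters through the maximum with \<open>norm (h 1)\<close> at the end.\<close>
  have *: "norm ((deriv ^^ n) h 1) / fact n \<le> C * (real n + 1) powr (b - 1)" if n: "n > 0" for n :: nat
  proof -
    define r where "r = real n / (real n + 1)"
    define d where "d = 1 - r"
    define D where "D = 2 * pi * M * 2 powr b / r ^ n"
    have r: "1/2 \<le> r" "r < 1" using n by (auto simp: r_def field_simps)
    have d: "d = 1 / (real n + 1)" "d > 0" by (auto simp: d_def r_def field_simps)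
    have D0: "D \<ge> 0" using M r by (simp add: D_def)
    have sub: "cball 1 r \<subseteq> ball (1::complex) 1" using r by auto
    \<comment> \<open>Cauchy's formula is unfolded to an integral over the parameter
      \<open>t\<close>, so that a bound depending on \<open>t\<close> can be integrated.\<close>
    define g where "g t = h (circlepath 1 r t) / (circlepath 1 r t - 1) ^ Suc n *
        vector_derivative (circlepath 1 r) (at t within {0..1})" for t
    have "((\<lambda>u. h u / (u - 1) ^ Suc n) has_contour_integral (2 * pi * \<i>) / fact n * (deriv ^^ n) h 1) (circlepath 1 r)"
      by (rule Cauchy_has_contour_integral_higher_derivative_circlepath)
        (use r sub hol in \<open>auto intro: continuous_on_subset[OF holomorphic_on_imp_continuous_on]
            holomorphic_on_subset ball_subset_cball[THEN subset_trans]\<close>)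
    then have I: "(g has_integral (2 * pi * \<i>) / fact n * (deriv ^^ n) h 1) {0..1}"
      unfolding has_contour_integral_def g_def .
    have gb: "norm (g t) \<le> D * (d + \<bar>t - 1/2\<bar>) powr (- b)" if t: "t \<in> {0..1}" for t
    proof -
      define e where "e = exp (2 * of_real pi * \<i> * of_real t)"
      have ne: "norm e = 1" by (simp add: e_def norm_exp_eq_Re)
      have e0: "e \<noteq> 0" by (simp add: e_def)
      have cp: "circlepath 1 r t = 1 + of_real r * e" by (simp add: circlepath e_def)
      have vd: "vector_derivative (circlepath 1 r) (at t within {0..1}) = 2 * pi * \<i> * r * e"
        using t by (simp add: vector_derivative_circlepath01 e_def)
      have inb: "1 + of_real r * e \<in> ball 1 1"
        using r ne by (simp add: dist_norm norm_mult)
      have "norm (g t) = norm (h (1 + of_real r * e)) * (2 * pi) / r ^ n"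
        using r by (simp add: g_def cp vd norm_mult norm_divide norm_power ne e0)
      also have "\<dots> \<le> M * norm (1 + of_real r * e) powr (- b) * (2 * pi) / r ^ n"
        using r by (intro divide_right_mono mult_right_mono M(2)[OF inb]) auto
      also have "\<dots> \<le> M * (2 powr b * (d + \<bar>t - 1/2\<bar>) powr (- b)) * (2 * pi) / r ^ n"
      proof (intro divide_right_mono mult_right_mono mult_left_mono M(1))
        have "norm (1 + of_real r * e) powr (- b) \<le> ((d + \<bar>t - 1/2\<bar>) / 2) powr (- b)"
          using norm_circle_ge[of r t] r t d b by (intro powr_mono2') (auto simp: d_def e_def)
        also have "\<dots> = 2 powr b * (d + \<bar>t - 1/2\<bar>) powr (- b)"
        proof -
          have "(x / 2) powr (- b) = 2 powr b * x powr (- b)" if "x > 0" for x :: real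
            using that by (simp add: powr_divide powr_minus_divide)
          then show ?thesis using d(2) by simp
        qed
        finally show "norm (1 + of_real r * e) powr (- b) \<le> 2 powr b * (d + \<bar>t - 1/2\<bar>) powr (- b)" .
      qed (use r in auto)
      finally show ?thesis by (simp add: D_def mult_ac)
    qed
    have "norm (integral {0..1} g) \<le> integral {0..1} (\<lambda>t. D * (d + \<bar>t - 1/2\<bar>) powr (- b))"
      by (rule integral_norm_bound_integral[OF has_integral_integrable[OF I] _ gb])
        (use powr_kernel_integral_le(1)[OF d(2) b(2)] in \<open>auto intro: integrable_on_mult_right\<close>)
    also have "\<dots> = D * integral {0..1} (\<lambda>t. (d + \<bar>t - 1/2\<bar>) powr (- b))" by simp
    also have "\<dots> \<le> D * (2 * d powr (1 - b) / (b - 1))"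
      by (intro mult_left_mono D0 powr_kernel_integral_le(2) d(2) b(2))
    also have "integral {0..1} g = (2 * pi * \<i>) / fact n * (deriv ^^ n) h 1" by (rule integral_unique[OF I])
    finally have "2 * pi * (norm ((deriv ^^ n) h 1) / fact n) \<le> D * (2 * d powr (1 - b) / (b - 1))"
      by (simp add: norm_mult norm_divide)
    also have "\<dots> = 2 * pi * (1 / r ^ n * (M * 2 powr b * (2 / (b - 1)) * d powr (1 - b)))"
      by (simp add: D_def)
    finally have "norm ((deriv ^^ n) h 1) / fact n \<le> 1 / r ^ n * (M * 2 powr b * (2 / (b - 1)) * d powr (1 - b))"
      by (rule mult_left_le_imp_le) simp
    also have "\<dots> \<le> exp 1 * (M * 2 powr b * (2 / (b - 1)) * d powr (1 - b))"
    proof (intro mult_right_mono)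
      \<comment> \<open>The choice of \<open>r\<close> keeps \<open>1 / r ^ n\<close> bounded
        although \<open>1 - r\<close> is as small as \<open>1 / (n + 1)\<close>.\<close>
      have "1 / r = 1 + 1 / real n" using n by (simp add: r_def field_simps)
      then have "1 / r ^ n = (1 + 1 / real n) ^ n" by (metis power_one_over)
      also have "\<dots> \<le> exp (1 / real n) ^ n"
        by (intro power_mono exp_ge_add_one_self) auto
      also have "\<dots> = exp 1" using n by (simp flip: exp_of_nat_mult)
      finally show "1 / r ^ n \<le> exp 1" .
    qed (use M b in auto)
    also have "d powr (1 - b) = (real n + 1) powr (b - 1)"
      by (simp add: d powr_divide powr_minus_divide[of _ "b - 1", symmetric] powr_minus)
        (simp add: powr_diff field_simps)
    finally show ?thesis by (simp add: C_def mult_ac)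
  qed
  have C: "norm ((deriv ^^ n) h 1) / fact n \<le> max C (norm (h 1)) * (real n + 1) powr (b - 1)" for n
  proof (cases "n = 0")
    case False
    then show ?thesis
      by (intro order_trans[OF *[of n] mult_right_mono]) auto
  qed simp
  show ?thesis by (rule that[OF C])
qed

end

section \<open>Absolute convergence and termwise integration\<close>

text \<open>Convergence of Euler's product \<open>Gamma_series\<close> gives
  \<open>fact n / pochhammer x (Suc n) = O(n powr (- x))\<close>, so the terms are
  \<open>O(n powr (b - 1 - x))\<close> with exponent below \<open>-1\<close>.\<close>

lemma summable_powr_fact_pochhammer:
  fixes b x :: real
  assumes b: "1 \<le> b" "b < x"
  shows "summable (\<lambda>n. (real n + 1) powr (b - 1) * (fact n / pochhammer x (Suc n)))"
proof -
  have "Bseq (Gamma_series x)"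
    using Gamma_series_LIMSEQ[of x] by (intro convergent_imp_Bseq) (auto simp: convergent_def)
  then obtain C where C: "\<And>n. norm (Gamma_series x n) \<le> C" unfolding Bseq_def by blast
  have sm: "summable (\<lambda>n. 2 powr (b - 1) * C * real n powr (b - 1 - x))"
    using b by (intro summable_mult) (simp add: summable_real_powr_iff)
  have "norm ((real n + 1) powr (b - 1) * (fact n / pochhammer x (Suc n))) \<le> 2 powr (b - 1) * C * real n powr (b - 1 - x)"
    if n: "n \<ge> 1" for n
  proof -
    have p: "pochhammer x (Suc n) > 0" using b by (intro pochhammer_pos) auto
    have "(real n + 1) powr (b - 1) \<le> (2 * real n) powr (b - 1)"
      using n b by (intro powr_mono2) auto
    also have "\<dots> = 2 powr (b - 1) * real n powr (b - 1)" by (simp add: powr_mult)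
    finally have 1: "(real n + 1) powr (b - 1) \<le> 2 powr (b - 1) * real n powr (b - 1)" .
    have "Gamma_series x n = fact n / pochhammer x (Suc n) * real n powr x"
      using n by (simp add: Gamma_series_def powr_def)
    then have "fact n / pochhammer x (Suc n) = Gamma_series x n * real n powr (- x)"
      using n by (simp add: powr_minus field_simps)
    also have "\<dots> \<le> C * real n powr (- x)"
      using C[of n] by (intro mult_right_mono) auto
    finally have 2: "fact n / pochhammer x (Suc n) \<le> C * real n powr (- x)" .
    have "(real n + 1) powr (b - 1) * (fact n / pochhammer x (Suc n)) \<le> (2 powr (b - 1) * real n powr (b - 1)) * (C * real n powr (- x))"
      using p by (intro mult_mono 1 2) auto
    also have "\<dots> = 2 powr (b - 1) * C * real n powr (b - 1 - x)"
      using powr_add[of "real n" "b - 1" "- x"] by simp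
    finally show ?thesis using p by (simp add: abs_mult)
  qed
  then show ?thesis by (intro summable_comparison_test'[OF sm])
qed

text \<open>Holds factor by factor; it reduces absolute convergence at complex \<open>z\<close> to
  the real argument \<open>Re z\<close>.\<close>

lemma norm_pochhammer_ge:
  fixes w :: complex
  assumes "Re w \<ge> 0"
  shows "pochhammer (Re w) n \<le> norm (pochhammer w n)"
  unfolding pochhammer_prod prod_norm[symmetric]
proof (rule prod_mono)
  fix k show "0 \<le> Re w + of_nat k \<and> Re w + of_nat k \<le> norm (w + of_nat k)"
    using assms complex_Re_le_cmod[of "w + of_nat k"] by simp
qed

text \<open>Evaluates the integrals of the norms when sum and integral are interchanged.\<close>

lemma Beta_integral_exp_real:
  fixes x :: real
  assumes lam: "lam > 0" and x: "x > 0"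
  shows "((\<lambda>t. exp (- (x * t)) * (1 - exp (- t / lam)) ^ n)
           has_integral lam * fact n / pochhammer (lam * x) (Suc n)) {0..}"
proof -
  have "((\<lambda>t. Re (exp (- (of_real x * of_real t)) * (1 - of_real (exp (- t / lam))) ^ n))
           has_integral Re (of_real lam * fact n / pochhammer (of_real lam * of_real x) (Suc n))) {0..}"
    using has_integral_linear[OF Beta_integral_exp[OF lam, of "of_real x" n] bounded_linear_Re] x
    by (simp add: o_def)
  moreover have "exp (- (of_real x * of_real t)) * (1 - of_real (exp (- t / lam))) ^ n
      = (of_real (exp (- (x * t)) * (1 - exp (- t / lam)) ^ n) :: complex)" for t
    by (simp flip: exp_of_real)
  moreover have "of_real lam * fact n / pochhammer (of_real lam * of_real x) (Suc n)
      = (of_real (lam * fact n / pochhammer (lam * x) (Suc n)) :: complex)"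
    by (simp add: pochhammer_of_real[symmetric] del: pochhammer_Suc)
  ultimately show ?thesis by (simp only: Re_complex_of_real)
qed

lemma integrable_lebesgue_on_iff:
  "S \<in> sets lebesgue \<Longrightarrow> integrable (lebesgue_on S) f \<longleftrightarrow> f absolutely_integrable_on S"
  by (simp add: integrable_restrict_space set_integrable_def)

context log_growth
begin

text \<open>The \<open>\<beta> n\<close> are the Taylor coefficients of \<open>h\<close> in powers
  of \<open>1 - s\<close>. Each power integrates to a Beta integral, and
  \<open>sums_integral\<close> permits the interchange once the integrals of the norms are
  summable.\<close>

lemma factorial_series:
  assumes lam: "lam > 0" and z: "Re z > c / lam" and z1: "lam * Re z > 1"
  defines "\<beta> \<equiv> \<lambda>n. (- 1) ^ n * (deriv ^^ n) h 1 / fact n"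
  shows "summable (\<lambda>n. norm (\<beta> n * fact n / pochhammer (of_real lam * z) (Suc n)))"
    and "(\<lambda>n. of_real lam * (\<beta> n * fact n / pochhammer (of_real lam * z) (Suc n))) sums integral {0..} (rem_integrand lam z 0)"
proof -
  let ?x = "lam * Re z"
  have xc: "?x > c" using z lam by (simp add: field_simps)
  \<comment> \<open>The midpoint leaves room on both sides: \<open>b > max c 1\<close> for the
    coefficient bound, \<open>b < lam * Re z\<close> for summability.\<close>
  define b where "b = (max c 1 + ?x) / 2"
  have b: "b \<ge> c" "b > 1" "b < ?x" using xc z1 by (auto simp: b_def)
  have Rz: "Re z > 0" using Re_pos[OF lam z] .
  obtain C where C: "\<And>n. norm ((deriv ^^ n) h 1) / fact n \<le> C * (real n + 1) powr (b - 1)"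
    using taylor_coeff_bound[OF b(1,2)] by blast
  have bC: "norm (\<beta> n) \<le> C * (real n + 1) powr (b - 1)" for n
    using C[of n] by (simp add: \<beta>_def norm_mult norm_divide norm_power)
  have P: "pochhammer ?x (Suc n) > 0" for n using z1 by (intro pochhammer_pos) auto
  have sm: "summable (\<lambda>n. norm (\<beta> n) * (fact n / pochhammer ?x (Suc n)))"
  proof (rule summable_comparison_test')
    show "summable (\<lambda>n. C * ((real n + 1) powr (b - 1) * (fact n / pochhammer ?x (Suc n))))"
      using summable_powr_fact_pochhammer[of b ?x] b by (intro summable_mult) auto
    show "norm (norm (\<beta> n) * (fact n / pochhammer ?x (Suc n))) \<le> C * ((real n + 1) powr (b - 1) * (fact n / pochhammer ?x (Suc n)))" for n
      using mult_right_mono[OF bC[of n], of "fact n / pochhammer ?x (Suc n)"] P[of n]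
      by (simp add: abs_mult mult_ac)
  qed
  show "summable (\<lambda>n. norm (\<beta> n * fact n / pochhammer (of_real lam * z) (Suc n)))"
  proof (rule summable_comparison_test'[OF sm])
    fix n
    have "fact n / norm (pochhammer (of_real lam * z) (Suc n)) \<le> fact n / pochhammer ?x (Suc n)"
      using norm_pochhammer_ge[of "of_real lam * z" "Suc n"] z1 P[of n]
      by (intro divide_left_mono mult_pos_pos) (auto simp del: pochhammer_Suc)
    from mult_left_mono[OF this, of "norm (\<beta> n)"]
    show "norm (norm (\<beta> n * fact n / pochhammer (of_real lam * z) (Suc n))) \<le> norm (\<beta> n) * (fact n / pochhammer ?x (Suc n))"
      by (simp add: norm_mult norm_divide)
  qed
  define e where "e n t = exp (- (z * of_real t)) * (1 - of_real (exp (- t / lam))) ^ n" for n and t :: real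
  let ?M = "lebesgue_on {0::real..}"
  have S: "{0::real..} \<in> sets lebesgue" by simp
  have ne: "norm (e n t) = exp (- (Re z * t)) * (1 - exp (- t / lam)) ^ n" if t: "t \<ge> 0" for n t
  proof -
    have "exp (- t / lam) \<le> 1" using t lam by simp
    then have "norm (1 - of_real (exp (- t / lam)) :: complex) = 1 - exp (- t / lam)"
      by (metis abs_of_nonneg diff_ge_0_iff_ge norm_of_real of_real_1 of_real_diff)
    then show ?thesis by (simp add: e_def norm_mult norm_power norm_exp_of_real_mult)
  qed
  have ai: "e n absolutely_integrable_on {0..}" for n
  proof (rule integrable_exp_decay(1)[where C = 1 and d = "Re z"])
    show "continuous_on {0..} (e n)" unfolding e_def using lam by (intro continuous_intros) auto
    show "norm (e n t) \<le> 1 * exp (- Re z * t)" if "t \<ge> 0" for t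
    proof -
      have "(1 - exp (- t / lam)) ^ n \<le> 1" using that lam by (intro power_le_one) auto
      then show ?thesis using ne[OF that, of n] by (simp add: mult_left_le)
    qed
  qed (rule Rz)
  have "(\<lambda>n. integral\<^sup>L ?M (\<lambda>t. \<beta> n * e n t)) sums (\<integral>t. (\<Sum>n. \<beta> n * e n t) \<partial>?M)"
  proof (rule sums_integral)
    show "integrable ?M (\<lambda>t. \<beta> n * e n t)" for n
      using ai by (intro integrable_mult_right) (simp add: integrable_lebesgue_on_iff)
    have "summable (\<lambda>n. norm (\<beta> n * e n t))" if t: "t \<ge> 0" for t
    proof -
      define s where "s = exp (- t / lam)"
      have s: "0 < s" "s \<le> 1" using t lam by (auto simp: s_def)
      \<comment> \<open>The point \<open>s / 2\<close> is farther from the centre \<open>1\<close>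
        than \<open>s\<close>, so convergence there gives absolute convergence at \<open>s\<close>.
        It is \<open>exp (- t)\<close> for \<open>t = - ln (s / 2)\<close>.\<close>
      have "of_real (s / 2) \<in> ball (1::complex) 1"
        using exp_in_ball[of 1 "- ln (s / 2)"] s by simp
      from holomorphic_power_series[OF hol this]
      have "summable (\<lambda>n. (deriv ^^ n) h 1 / fact n * (of_real (s / 2) - 1) ^ n)" by (rule sums_summable)
      moreover have "norm (of_real x - 1 :: complex) = 1 - x" if "x \<le> 1" for x
        using that by (metis abs_of_nonneg diff_ge_0_iff_ge norm_minus_commute norm_of_real of_real_1 of_real_diff)
      then have "norm (of_real s - 1 :: complex) < norm (of_real (s / 2) - 1 :: complex)"
        using s by (simp del: of_real_divide)
      ultimately have "summable (\<lambda>n. norm ((deriv ^^ n) h 1 / fact n * (of_real s - 1) ^ n))"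
        by (rule powser_insidea)
      from summable_mult[OF this, of "exp (- (Re z * t))"]
      show ?thesis
        by (rule summable_cong[THEN iffD1, rotated])
          (simp add: \<beta>_def e_def s_def norm_mult norm_divide norm_power norm_exp_of_real_mult norm_minus_commute mult_ac)
    qed
    then show "AE t in ?M. summable (\<lambda>n. norm (\<beta> n * e n t))" by (intro AE_I2) (simp add: space_restrict_space)
    have "(\<integral>t. norm (\<beta> n * e n t) \<partial>?M) = lam * (norm (\<beta> n) * (fact n / pochhammer ?x (Suc n)))" for n
    proof -
      have "integrable ?M (\<lambda>t. norm (\<beta> n * e n t))"
        using ai by (intro integrable_norm integrable_mult_right) (simp add: integrable_lebesgue_on_iff)
      then have "(\<integral>t. norm (\<beta> n * e n t) \<partial>?M) = integral {0..} (\<lambda>t. norm (\<beta> n * e n t))"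
        by (rule lebesgue_integral_eq_integral[OF _ S])
      also have "\<dots> = integral {0..} (\<lambda>t. norm (\<beta> n) * (exp (- (Re z * t)) * (1 - exp (- t / lam)) ^ n))"
        by (rule integral_cong) (simp add: norm_mult ne)
      also have "\<dots> = norm (\<beta> n) * (lam * fact n / pochhammer ?x (Suc n))"
        by (rule integral_unique[OF has_integral_mult_right[OF Beta_integral_exp_real[OF lam Rz]]])
      finally show ?thesis by simp
    qed
    then show "summable (\<lambda>n. \<integral>t. norm (\<beta> n * e n t) \<partial>?M)" by (simp only: summable_mult[OF sm])
  qed
  moreover have "integral\<^sup>L ?M (\<lambda>t. \<beta> n * e n t) = of_real lam * (\<beta> n * fact n / pochhammer (of_real lam * z) (Suc n))" for n
  proof -
    have "integrable ?M (\<lambda>t. \<beta> n * e n t)"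
      using ai by (intro integrable_mult_right) (simp add: integrable_lebesgue_on_iff)
    then have "integral\<^sup>L ?M (\<lambda>t. \<beta> n * e n t) = integral {0..} (\<lambda>t. \<beta> n * e n t)"
      by (rule lebesgue_integral_eq_integral[OF _ S])
    also have "\<dots> = \<beta> n * (of_real lam * fact n / pochhammer (of_real lam * z) (Suc n))"
      unfolding e_def by (rule integral_unique[OF has_integral_mult_right[OF Beta_integral_exp[OF lam Rz]]])
    finally show ?thesis by simp
  qed
  moreover have "(\<integral>t. (\<Sum>n. \<beta> n * e n t) \<partial>?M) = integral {0..} (rem_integrand lam z 0)"
  proof -
    have "(\<Sum>n. \<beta> n * e n t) = rem_integrand lam z 0 t" if t: "t \<ge> 0" for t
    proof -
      let ?s = "of_real (exp (- t / lam)) :: complex"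
      have "(\<lambda>n. exp (- (z * of_real t)) * ((deriv ^^ n) h 1 / fact n * (?s - 1) ^ n)) sums (exp (- (z * of_real t)) * h ?s)"
        by (intro sums_mult holomorphic_power_series[OF hol] exp_in_ball lam t)
      moreover have "exp (- (z * of_real t)) * ((deriv ^^ n) h 1 / fact n * (?s - 1) ^ n) = \<beta> n * e n t" for n
      proof -
        have "(?s - 1) ^ n = (- 1) ^ n * (1 - ?s) ^ n" by (simp flip: power_mult_distrib)
        then show ?thesis by (simp add: \<beta>_def e_def)
      qed
      ultimately show ?thesis by (simp add: rem_integrand_def sums_iff)
    qed
    then have "(\<integral>t. (\<Sum>n. \<beta> n * e n t) \<partial>?M) = (\<integral>t. rem_integrand lam z 0 t \<partial>?M)"
      by (intro Bochner_Integration.integral_cong) (auto simp: space_restrict_space)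
    also have "\<dots> = integral {0..} (rem_integrand lam z 0)"
      using rem_integrand_absolutely_integrable[OF lam z] by (intro lebesgue_integral_eq_integral[OF _ S]) (simp add: integrable_lebesgue_on_iff)
    finally show ?thesis .
  qed
  ultimately show "(\<lambda>n. of_real lam * (\<beta> n * fact n / pochhammer (of_real lam * z) (Suc n))) sums integral {0..} (rem_integrand lam z 0)"
    by simp
qed

end

section \<open>Identification of \<open>b_lam\<close> and proof of the theorem\<close>

lemma ball_1_1_nonpos_Reals: "ball 1 1 \<inter> \<real>\<^sub>\<le>\<^sub>0 = ({} :: complex set)"
proof -
  have "Re s > 0" if "s \<in> ball 1 1" for s :: complex
    using that abs_Re_le_cmod[of "1 - s"] by (auto simp: dist_norm)
  then show ?thesis by (force simp: complex_nonpos_Reals_iff)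
qed

text \<open>The Stirling formula is evaluated at \<open>s = 1\<close>, where \<open>Ln s = 0\<close>
  and the derivatives of \<open>F\<close> are the numbers \<open>a (Suc j)\<close>; the scaling by
  \<open>- lam\<close> contributes \<open>(- lam) ^ j\<close>.\<close>

lemma higher_deriv_pullback:
  assumes gev: "gevrey1 a" and lam: "lam > 0" and r: "r > 0"
    and F: "F holomorphic_on ball 0 r"
    and eq: "\<And>\<zeta>. \<zeta> \<in> ball 0 r \<Longrightarrow> F \<zeta> = borel_transform a \<zeta>"
  shows "(deriv ^^ n) (\<lambda>s. F (- of_real lam * Ln s)) 1 = (- 1) ^ n * fact n * b_lam lam a n"
proof -
  define T where "T = ball (0::complex) (r / lam)"
  \<comment> \<open>The disc is cut down so that \<open>- lam * Ln s\<close> stays in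
    \<open>ball 0 r\<close>, where \<open>F\<close> is assumed holomorphic.\<close>
  define S where "S = ball 1 1 \<inter> Ln -` T"
  define G where "G x = F (- of_real lam * x)" for x
  have T: "- of_real lam * x \<in> ball 0 r" if "x \<in> T" for x
    using that lam by (simp add: T_def norm_mult field_simps)
  have G: "G holomorphic_on T"
    unfolding G_def
    by (rule holomorphic_on_compose_gen[OF _ F, unfolded o_def]) (use T in \<open>auto intro!: holomorphic_intros\<close>)
  have S: "open S" unfolding S_def
    by (rule continuous_open_preimage) (use ball_1_1_nonpos_Reals in \<open>auto simp: T_def intro!: continuous_intros\<close>)
  have s1: "1 \<in> S" using r lam by (simp add: S_def T_def)
  have dG: "(deriv ^^ j) G 0 = (- of_real lam) ^ j * a (Suc j)" for j
    using higher_deriv_compose_linear[OF F, of T 0 "- of_real lam" j] T r lam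
      borel_transform_higher_deriv_0[OF gev r eq]
    by (simp add: G_def[abs_def] T_def)
  have "(deriv ^^ n) (\<lambda>s. F (- of_real lam * Ln s)) 1 = (deriv ^^ n) (\<lambda>s. G (Ln s)) 1"
    by (simp add: G_def)
  also have "\<dots> = (\<Sum>j\<le>n. of_int (stirling1 n j) * ((- of_real lam) ^ j * a (Suc j)))"
    using higher_deriv_compose_Ln[OF G _ S _ _ s1, of n] ball_1_1_nonpos_Reals
    by (auto simp: T_def S_def dG)
  also have "\<dots> = (- 1) ^ n * (\<Sum>j\<le>n. (- 1) ^ (n - j) * of_int (stirling1 n j) * (of_real lam ^ j * a (Suc j)))"
    unfolding sum_distrib_left
  proof (rule sum.cong)
    fix j assume "j \<in> {..n}"
    then have "(- 1) ^ n * (- 1) ^ (n - j) = ((- 1) ^ j :: complex)"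
      by (metis (no_types, lifting) atMost_iff le_add_diff_inverse2 left_minus_one_mult_self mult.commute power_add)
    then have "(- 1) ^ n * ((- 1) ^ (n - j) * of_int (stirling1 n j) * (of_real lam ^ j * a (Suc j)))
      = (- 1) ^ j * of_int (stirling1 n j) * (of_real lam ^ j * a (Suc j))"
      by (simp only: mult.assoc[symmetric])
    then show "of_int (stirling1 n j) * ((- of_real lam) ^ j * a (Suc j)) =
      (- 1) ^ n * ((- 1) ^ (n - j) * of_int (stirling1 n j) * (of_real lam ^ j * a (Suc j)))"
      by (simp only: power_minus[of "of_real lam"] mult_ac)
  qed simp
  also have "(\<Sum>j\<le>n. (- 1) ^ (n - j) * of_int (stirling1 n j) * (of_real lam ^ j * a (Suc j)))
     = (\<Sum>k=1..n+1. (-1) ^ (n + 1 - k) * of_int (stirling1 n (k - 1)) * a_lam lam a k)"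
    \<comment> \<open>With \<open>k = j + 1\<close>, the exponent \<open>k - 1\<close> in
      \<open>a_lam\<close> and the Stirling index \<open>k - 1\<close> both become
      \<open>j\<close>.\<close>
    by (rule sum.reindex_bij_witness[of _ "\<lambda>k. k - 1" Suc]) (auto simp: a_lam_def)
  finally show ?thesis by (simp add: b_lam_def)
qed

theorem theorem3p2:
  fixes a :: "nat \<Rightarrow> complex" and F :: "complex \<Rightarrow> complex"
    and lam A B :: real
  assumes gev: "gevrey1 a"
    and lam: "lam > 0"
    and hol: "F holomorphic_on Delta_lam lam"
    and ext: "\<exists>r>0. ball 0 r \<subseteq> Delta_lam lam \<and>
                (\<forall>\<zeta>\<in>ball 0 r. F \<zeta> = borel_transform a \<zeta>)"
    and A: "A > 0" and B: "B > 0"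
    and bound: "\<forall>\<zeta>\<in>Delta_lam lam. norm (F \<zeta>) \<le> A * exp (B * norm \<zeta>)"
  shows "(\<forall>z. Re z > max B (1 / lam) \<longrightarrow>
            summable (\<lambda>n. norm (fact_term lam a z n)) \<and>
            a 0 + of_real lam * (\<Sum>n. fact_term lam a z n) = borel_sum (a 0) F z)
       \<and> (\<forall>N::nat. \<forall>z. Re z > B \<longrightarrow>
            norm (borel_sum (a 0) F z
                  - (a 0 + of_real lam * (\<Sum>n\<le>N. fact_term lam a z n)))
              \<le> R_fact lam A B N z)"
proof -
  define h where "h s = F (- of_real lam * Ln s)" for s
  define c where "c = lam * B"
  have c: "c > 0" "c / lam = B" using lam B by (auto simp: c_def)
  have in_Delta: "- of_real lam * Ln s \<in> Delta_lam lam" if "s \<in> ball 1 1" for s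
    using that unfolding Delta_lam_def Delta_def by (intro image_eqI[of _ _ "- Ln s"] image_eqI[of _ _ s]) auto
  obtain r where r: "r > 0" "ball 0 r \<subseteq> Delta_lam lam" "\<And>\<zeta>. \<zeta> \<in> ball 0 r \<Longrightarrow> F \<zeta> = borel_transform a \<zeta>"
    using ext by blast
  have coeff: "(deriv ^^ n) h 1 = (- 1) ^ n * fact n * b_lam lam a n" for n
    using higher_deriv_pullback[OF gev lam r(1) holomorphic_on_subset[OF hol r(2)] r(3), of n]
    by (simp add: h_def[abs_def])
  interpret log_growth h A c
  proof
    show "h holomorphic_on ball 1 1"
      unfolding h_def
      by (rule holomorphic_on_compose_gen[OF _ hol, unfolded o_def])
        (use in_Delta ball_1_1_nonpos_Reals in \<open>auto intro!: holomorphic_intros\<close>)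
    show "norm (h s) \<le> A * exp (c * norm (Ln s))" if "s \<in> ball 1 1" for s
      using bound in_Delta[OF that] lam by (force simp: h_def c_def norm_mult mult_ac)
  qed (use A c in auto)
  have sum: "borel_sum (a 0) F z = a 0 + integral {0..} (rem_integrand lam z 0)" for z
  proof -
    have "rem_integrand lam z 0 t = F (of_real t) * exp (- (z * of_real t))" for t
    proof -
      \<comment> \<open>On the positive axis the principal logarithm is real, so
        \<open>- lam * Ln s\<close> returns \<open>t\<close> and index \<open>0\<close> gives the
        Laplace integrand itself.\<close>
      have "Ln (of_real (exp (- t / lam))) = of_real (- t / lam)" by (subst Ln_of_real) auto
      then show ?thesis using lam by (simp add: rem_integrand_def h_def)
    qed
    then have "rem_integrand lam z 0 = (\<lambda>t. F (of_real t) * exp (- (z * of_real t)))" by blast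
    then show ?thesis by (simp add: borel_sum_def)
  qed
  have ft: "fact_term lam a z n = b_lam lam a n * fact n / pochhammer (of_real lam * z) (Suc n)"
    and Gp: "Gamma (of_real lam * z) / Gamma (of_real lam * z + of_nat n + 1) = 1 / pochhammer (of_real lam * z) (Suc n)"
    if z: "Re z > B" for z n
  proof -
    have "Re (of_real lam * z) > 0" using z B lam by simp
    then have ni: "of_real lam * z \<notin> \<int>\<^sub>\<le>\<^sub>0"
      by (metis complex_nonpos_Reals_iff nonpos_Ints_subset_nonpos_Reals not_le subsetD)
    show *: "Gamma (of_real lam * z) / Gamma (of_real lam * z + of_nat n + 1) = 1 / pochhammer (of_real lam * z) (Suc n)"
      by (simp add: pochhammer_Gamma[OF ni, of "Suc n"] add_ac del: pochhammer_Suc)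
    have "Gamma (of_nat n + 1) = (fact n :: complex)" by (simp add: Gamma_fact add.commute)
    then have "fact_term lam a z n = b_lam lam a n * fact n * (Gamma (of_real lam * z) / Gamma (of_real lam * z + of_nat n + 1))"
      by (simp add: fact_term_def)
    then show "fact_term lam a z n = b_lam lam a n * fact n / pochhammer (of_real lam * z) (Suc n)"
      unfolding * by simp
  qed
  show ?thesis
  proof (intro conjI allI impI)
    fix z assume z: "Re z > max B (1 / lam)"
    then have z': "Re z > c / lam" "lam * Re z > 1" "Re z > B" using lam c by (auto simp: field_simps)
    have be: "(- 1) ^ n * (deriv ^^ n) h 1 / fact n = b_lam lam a n" for n
      by (simp add: coeff)
    note fs = factorial_series[OF lam z'(1,2), unfolded be, folded ft[OF z'(3)]]
    show "summable (\<lambda>n. norm (fact_term lam a z n))" by (rule fs)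
    then have "summable (fact_term lam a z)" by (rule summable_norm_cancel)
    then have "of_real lam * (\<Sum>n. fact_term lam a z n) = (\<Sum>n. of_real lam * fact_term lam a z n)"
      by (rule suminf_mult[symmetric])
    also have "\<dots> = integral {0..} (rem_integrand lam z 0)" using fs(2) by (simp add: sums_iff)
    finally show "a 0 + of_real lam * (\<Sum>n. fact_term lam a z n) = borel_sum (a 0) F z"
      by (simp add: sum)
  next
    fix N :: nat and z assume z: "Re z > B"
    then have z': "Re z > c / lam" using c by simp
    let ?p = "pochhammer (of_real lam * z) (Suc N)"
    have tm: "fact_term lam a z n = (- 1) ^ n * (deriv ^^ n) h 1 / pochhammer (of_real lam * z) (Suc n)" for n
      by (simp add: ft[OF z] coeff mult_ac del: pochhammer_Suc)
    \<comment> \<open>The partial sum includes \<open>n = N\<close>, hence \<open>N + 1\<close>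
      integrations by parts and a remainder of index \<open>Suc N\<close>.\<close>
    have "borel_sum (a 0) F z - (a 0 + of_real lam * (\<Sum>n\<le>N. fact_term lam a z n))
        = (- 1) ^ Suc N / ?p * integral {0..} (rem_integrand lam z (Suc N))"
      by (simp add: sum integral_rem_integrand_expansion[OF lam z', of "Suc N"] tm lessThan_Suc_atMost del: pochhammer_Suc)
    then have "norm (borel_sum (a 0) F z - (a 0 + of_real lam * (\<Sum>n\<le>N. fact_term lam a z n)))
        = norm (integral {0..} (rem_integrand lam z (Suc N))) / norm ?p"
      by (simp add: norm_mult norm_divide norm_power del: pochhammer_Suc)
    \<comment> \<open>This \<open>\<rho>\<close> minimises \<open>(1 - \<rho>) powr - c / \<rho> ^ (N + 1)\<close>.\<close>
    define \<rho> where "\<rho> = (real N + 1) / (real N + c + 1)"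
    have \<rho>: "0 < \<rho>" "\<rho> < 1" using c by (auto simp: \<rho>_def)
    define q where "q = real N + c + 1"
    have q: "q > 0" using c by (simp add: q_def)
    have "norm (integral {0..} (rem_integrand lam z (Suc N))) \<le> fact (Suc N) * A * (1 - \<rho>) powr (- c) / \<rho> ^ Suc N / (Re z - B)"
      using norm_integral_rem_integrand_le[OF lam z' \<rho>, of "Suc N"] c by simp
    also have "(1 - \<rho>) powr (- c) = q powr c / c powr c"
    proof -
      have "1 - \<rho> = c / q" using q by (simp add: \<rho>_def q_def field_simps)
      then show ?thesis using q c by (simp add: powr_divide powr_minus)
    qed
    also have "\<rho> ^ Suc N = (real N + 1) ^ Suc N / q powr (real N + 1)"
    proof -
      have "q powr (real N + 1) = q ^ Suc N" using powr_realpow[OF q, of "Suc N"] by (simp add: add.commute)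
      moreover have "\<rho> = (real N + 1) / q" by (simp add: \<rho>_def q_def)
      ultimately show ?thesis by (simp only: power_divide)
    qed
    also have "fact (Suc N) * A * (q powr c / c powr c) / ((real N + 1) ^ Suc N / q powr (real N + 1)) / (Re z - B)
       = A / c powr c * (q powr q / (real N + 1) ^ N) * (fact N / (Re z - B))"
    proof -
      \<comment> \<open>The two powers of \<open>q\<close> merge since
        \<open>q = c + (N + 1)\<close>, and \<open>fact (Suc N)\<close> cancels one factor
        \<open>N + 1\<close>, which leaves the exponent \<open>N\<close> in the denominator of
        \<open>R_fact\<close>.\<close>
      have "q powr q = q powr c * q powr (real N + 1)" by (simp add: q_def flip: powr_add) (simp add: add_ac)
      moreover have "fact (Suc N) = (real N + 1) * fact N" by simp
      moreover have "real N + 1 \<noteq> 0" by simp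
      ultimately show ?thesis by (simp only: power_Suc) (simp add: divide_simps)
    qed
    finally have I: "norm (integral {0..} (rem_integrand lam z (Suc N)))
        \<le> A / c powr c * (q powr q / (real N + 1) ^ N) * (fact N / (Re z - B))" .
    have "R_fact lam A B N z = A / c powr c * (q powr q / (real N + 1) ^ N) * (fact N / (Re z - B)) / norm ?p"
    proof -
      have "Gamma (of_nat N + 1) = (fact N :: complex)" by (simp add: Gamma_fact add.commute)
      then have "Gamma (of_real lam * z) * Gamma (of_nat N + 1) / (Gamma (of_real lam * z + of_nat N + 1) * of_real (Re z - B))
        = (Gamma (of_real lam * z) / Gamma (of_real lam * z + of_nat N + 1)) * (fact N / of_real (Re z - B))"
        by simp
      then have "norm (Gamma (of_real lam * z) * Gamma (of_nat N + 1) / (Gamma (of_real lam * z + of_nat N + 1) * of_real (Re z - B)))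
        = fact N / (Re z - B) / norm ?p"
        using z unfolding Gp[OF z] by (simp add: norm_mult norm_divide del: pochhammer_Suc of_real_diff)
      then show ?thesis by (simp add: R_fact_def c_def q_def)
    qed
    with I show "norm (borel_sum (a 0) F z - (a 0 + of_real lam * (\<Sum>n\<le>N. fact_term lam a z n))) \<le> R_fact lam A B N z"
      unfolding \<open>norm (borel_sum (a 0) F z - (a 0 + of_real lam * (\<Sum>n\<le>N. fact_term lam a z n)))
        = norm (integral {0..} (rem_integrand lam z (Suc N))) / norm ?p\<close>
      by (simp only: divide_right_mono norm_ge_zero)
  qed
qed

end
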